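(* Let $m>n\ge 1$, $A\in\mathbb{R}^{m\times n}$, $b\in\mathbb{R}^m$ satisfy $0<\sigma_{n+1}<\hat\sigma_n$, let $x$ be the TLS solution, assume $x\ne 0$, and put $\alpha=\frac{1}{\sqrt{1+\|x\|^2}}$. Let $[\beta_1,\ldots,\beta_n,-\alpha]$ be the last row of $V$, and let $s_i=\frac{\sqrt{\sigma_i^2+\sigma_{n+1}^2}}{\sigma_i^2-\sigma_{n+1}^2}$, $i=1,\ldots,n$. Define $$\underline{\kappa}:=\frac12\left(\frac{\alpha^{-2}\sqrt{\beta_1^2s_1^2+\cdots+\beta_n^2s_n^2}}{\sqrt{1-\alpha^2}}+\frac{\sqrt{1-\alpha^2-\beta_n^2}}{\sqrt{1-\alpha^2}}\,\alpha^{-1}s_n\right),$$ $$\bar{\kappa}:=\frac{\alpha^{-2}\sqrt{\beta_1^2s_1^2+\cdots+\beta_n^2s_n^2}}{\sqrt{1-\alpha^2}}+\alpha^{-1}s_n.$$ Then $\underline{\kappa}\le\kappa_g(A,b)\le\bar{\kappa}$. Moreover, if $\alpha\le\frac12$, then $\underline{\kappa}<\bar{\kappa}<4\underline{\kappa}$.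
   Context: $\|\cdot\|$ is the Euclidean norm for vectors and the spectral norm for matrices; $\|\cdot\|_F$ is the Frobenius norm. $\hat\sigma_1\ge\cdots\ge\hat\sigma_n$ are the singular values of $A$, and $U^T[A\ \,b]V=\mathrm{diag}(\sigma_1,\ldots,\sigma_{n+1})$ is the thin SVD of $[A\ \,b]$, with $\sigma_1\ge\cdots\ge\sigma_{n+1}$, $U\in\mathbb{R}^{m\times(n+1)}$, $U^TU=I_{n+1}$, $V=[v_1,\ldots,v_{n+1}]\in\mathbb{R}^{(n+1)\times(n+1)}$, $V^TV=I_{n+1}$. The total least squares (TLS) problem is $\min\|[E\ \,r]\|_F$ subject to $b-r\in\mathcal{R}(A+E)$ ($\mathcal R$ = range); under $\sigma_{n+1}<\hat\sigma_n$ its unique solution is $x=(A^TA-\sigma_{n+1}^2I_n)^{-1}A^Tb$. One has $|V(n+1,n+1)|=1/\sqrt{1+\|x\|^2}$, and the sign of $v_{n+1}$ is chosen so that $v_{n+1}=\frac{1}{\sqrt{1+\|x\|^2}}[x^T,-1]^T$. Absolute condition number: for $(\tilde A,\tilde b)$ in a small neighbourhood of $(A,b)$, let $\tilde\sigma_{n+1}$ be the smallest singular value of $[\tilde A\ \,\tilde b]$ and let $g:\mathbb{R}^{m(n+1)}\to\mathbb{R}^n$ be the map $[\mathrm{vec}(\tilde A)^T,\tilde b^T]^T\mapsto(\tilde A^T\tilde A-\tilde\sigma_{n+1}^2I_n)^{-1}\tilde A^T\tilde b$, i.e. the TLS solution map, where $\mathrm{vec}$ stacks columns. Then $\kappa_g(A,b):=\|g'([\mathrm{vec}(A)^T,b^T]^T)\|$,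 the spectral norm of the derivative of $g$ at $(A,b)$. *)

theory Defs
  imports "HOL-Analysis.Analysis"
begin

text \<open>
  Vectors of length \<open>n + 1\<close> are indexed by \<open>'n + 1\<close>, where the right summand is the
  one-element numeral type: \<open>Inl i\<close> with \<open>i :: 'n\<close> are the first \<open>n\<close> indices in the order of \<open>'n\<close>,
  and \<open>Inr 1\<close> is the last one. The norm of \<open>real^'n^'m\<close> is the Frobenius norm.
\<close>

definition snoc_vec :: "real^'n \<Rightarrow> real \<Rightarrow> real^('n + 1)"
  where "snoc_vec v c = (\<chi> k. case k of Inl j \<Rightarrow> v $ j | Inr _ \<Rightarrow> c)"

definition snoc_col :: "real^'n^'m \<Rightarrow> real^'m \<Rightarrow> real^('n + 1)^'m"
  where "snoc_col A b = (\<chi> i. snoc_vec (A $ i) (b $ i))"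

definition diag :: "real^'k \<Rightarrow> real^'k^'k"
  where "diag d = (\<chi> i j. if i = j then d $ i else 0)"

text \<open>
  The factorization is stated as \<open>M = U \<Sigma> V\<^sup>T\<close>. For \<open>m > n + 1\<close> the identity \<open>U\<^sup>T M V = \<Sigma>\<close>, which
  follows from it, would not suffice: it does not force the range of \<open>M\<close> into the span of the
  columns of \<open>U\<close>.
\<close>

definition thin_svd ::
  "real^('n::{finite,linorder} + 1)^'m \<Rightarrow> real^('n + 1)^'m \<Rightarrow> real^('n + 1) \<Rightarrow> real^('n + 1)^('n + 1) \<Rightarrow> bool"
  where "thin_svd M U \<sigma> V \<longleftrightarrow>
    transpose U ** U = mat 1 \<and>
    transpose V ** V = mat 1 \<and>
    M = U ** diag \<sigma> ** transpose V \<and>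
    (\<forall>i j. i \<le> j \<longrightarrow> \<sigma> $ Inl j \<le> \<sigma> $ Inl i) \<and>
    (\<forall>i. \<sigma> $ Inr 1 \<le> \<sigma> $ Inl i) \<and>
    0 \<le> \<sigma> $ Inr 1"

text \<open>
  Square roots of the eigenvalues of \<open>M\<^sup>T M\<close>; meant for matrices with at least as many rows as
  columns (otherwise \<open>0\<close> would always be included).
\<close>

definition singular_value :: "real^'k^'m \<Rightarrow> real \<Rightarrow> bool"
  where "singular_value M s \<longleftrightarrow>
    0 \<le> s \<and> (\<exists>v. v \<noteq> 0 \<and> (transpose M ** M) *v v = s\<^sup>2 *\<^sub>R v)"

definition smallest_singular_value :: "real^'k^'m \<Rightarrow> real"
  where "smallest_singular_value M = (LEAST s. singular_value M s)"

definition tls_feasible :: "real^'n^'m \<Rightarrow> real^'m \<Rightarrow> real^'n^'m \<Rightarrow> real^'m \<Rightarrow> bool"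
  where "tls_feasible A b E r \<longleftrightarrow> b - r \<in> range (\<lambda>y. (A + E) *v y)"

definition tls_solution :: "real^'n^'m \<Rightarrow> real^'m \<Rightarrow> real^'n \<Rightarrow> bool"
  where "tls_solution A b x \<longleftrightarrow>
    (\<exists>E r. (A + E) *v x = b - r \<and>
      (\<forall>E' r'. tls_feasible A b E' r' \<longrightarrow> norm (snoc_col E r) \<le> norm (snoc_col E' r')))"

text \<open>
  The pair \<open>(A, b)\<close> stands for the stacked vector \<open>[vec(A)\<^sup>T, b\<^sup>T]\<^sup>T\<close>: the norm of the product type
  \<open>(real^'n^'m) \<times> (real^'m)\<close> is the Euclidean norm of that vector, so \<^const>\<open>onorm\<close> of the derivative
  is the spectral norm of the Jacobian matrix.
\<close>

definition tls_map :: "(real^'n^'m) \<times> (real^'m) \<Rightarrow> real^'n"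
  where "tls_map = (\<lambda>(A, b).
    matrix_inv (transpose A ** A - mat ((smallest_singular_value (snoc_col A b))\<^sup>2))
      *v (transpose A *v b))"

definition tls_cond :: "real^'n^'m \<Rightarrow> real^'m \<Rightarrow> real"
  where "tls_cond A b = onorm (frechet_derivative tls_map (at (A, b)))"

definition s_coeff :: "real^('n::finite + 1) \<Rightarrow> 'n \<Rightarrow> real"
  where "s_coeff \<sigma> i =
    sqrt ((\<sigma> $ Inl i)\<^sup>2 + (\<sigma> $ Inr 1)\<^sup>2) / ((\<sigma> $ Inl i)\<^sup>2 - (\<sigma> $ Inr 1)\<^sup>2)"

text \<open>In the following two bounds, \<open>Max UNIV\<close> is the index \<open>n\<close>.\<close>

definition kappa_lower :: "real \<Rightarrow> real^('n::{finite,linorder}) \<Rightarrow> real^('n + 1) \<Rightarrow> real"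
  where "kappa_lower \<alpha> \<beta> \<sigma> = 1 / 2 *
    ((1 / \<alpha>\<^sup>2) * sqrt (\<Sum>i\<in>UNIV. (\<beta> $ i)\<^sup>2 * (s_coeff \<sigma> i)\<^sup>2) / sqrt (1 - \<alpha>\<^sup>2) +
     sqrt (1 - \<alpha>\<^sup>2 - (\<beta> $ Max UNIV)\<^sup>2) / sqrt (1 - \<alpha>\<^sup>2) * (1 / \<alpha>) * s_coeff \<sigma> (Max UNIV))"

definition kappa_upper :: "real \<Rightarrow> real^('n::{finite,linorder}) \<Rightarrow> real^('n + 1) \<Rightarrow> real"
  where "kappa_upper \<alpha> \<beta> \<sigma> =
    (1 / \<alpha>\<^sup>2) * sqrt (\<Sum>i\<in>UNIV. (\<beta> $ i)\<^sup>2 * (s_coeff \<sigma> i)\<^sup>2) / sqrt (1 - \<alpha>\<^sup>2) +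
    (1 / \<alpha>) * s_coeff \<sigma> (Max UNIV)"

end

theory Submission
  imports Defs
begin

text \<open>
  Let \<open>v\<^sub>k\<close> be the columns of \<open>V\<close>, let \<open>w\<^sub>i\<close> consist of the first \<open>n\<close> entries of \<open>v\<^sub>i\<close> (\<open>i \<le> n\<close>), write
  \<open>s = \<sigma>\<^sub>n\<^sub>+\<^sub>1\<close> and \<open>\<rho> = b - A x\<close>. Then \<open>P = A\<^sup>T A - s\<^sup>2 I = \<Sum>\<^sub>i (\<sigma>\<^sub>i\<^sup>2 - s\<^sup>2) w\<^sub>i w\<^sub>i\<^sup>T\<close>. Since \<open>s\<^sup>2\<close> is a simple
  eigenvalue of the Gram matrix of \<open>[A b]\<close>, it is differentiable, and differentiating \<open>P x = A\<^sup>T b\<close>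
  gives \<open>dx = P\<^sup>-\<^sup>1 (dA\<^sup>T \<rho> + A\<^sup>T \<delta> + 2 \<alpha>\<^sup>2 (\<rho> \<bullet> \<delta>) x)\<close> with
  \<open>\<delta> = db - dA x\<close>. The orthogonality of \<open>V\<close> shows that the vectors \<open>t\<^sub>i = w\<^sub>i + \<beta>\<^sub>i x\<close> are dual to the \<open>w\<^sub>i\<close>, and the adjoint \<open>J\<^sup>T\<close> of the derivative satisfies
  \<open>\<parallel>J\<^sup>T y\<parallel>\<^sup>2 = \<alpha>\<^sup>-\<^sup>2 \<Sum>\<^sub>i s\<^sub>i\<^sup>2 (t\<^sub>i \<bullet> y)\<^sup>2\<close>. The upper bound is the triangle inequality for
  \<open>t\<^sub>i \<bullet> y = w\<^sub>i \<bullet> y + \<beta>\<^sub>i (x \<bullet> y)\<close>; testing with \<open>y = x\<close> and with \<open>y = t\<^sub>n\<close> shows that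
  \<open>\<kappa>\<close> dominates both numbers of which the lower bound is the average.
\<close>

subsection \<open>Matrices and bordered vectors\<close>

lemma bounded_bilinear_matrix_vector_mult:
  "bounded_bilinear (\<lambda>(A::real^'n^'m) x. A *v x)"
  unfolding bilinear_conv_bounded_bilinear[symmetric] bilinear_def
  by (auto intro!: linearI simp: matrix_vector_mult_add_rdistrib matrix_vector_right_distrib
      scaleR_matrix_vector_assoc matrix_vector_mult_scaleR)

lemma bounded_bilinear_matrix_matrix_mult:
  "bounded_bilinear (\<lambda>(A::real^'n^'m) (B::real^'k^'n). A ** B)"
  unfolding bilinear_conv_bounded_bilinear[symmetric] bilinear_def
  by (auto intro!: linearI simp: matrix_matrix_mult_def vec_eq_iff sum.distrib algebra_simps
      sum_distrib_left)

lemma bounded_linear_transpose: "bounded_linear (transpose :: real^'n^'m \<Rightarrow> real^'m^'n)"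
  unfolding linear_conv_bounded_linear[symmetric]
  by (auto intro!: linearI simp: transpose_def vec_eq_iff)

lemma mat_eq_scaleR_mat_1: "mat c = c *\<^sub>R (mat 1 :: real^'n^'n)"
  by (simp add: mat_def vec_eq_iff)

lemma inner_transpose_matrix_vector_mult:
  fixes A :: "real^'n^'m"
  shows "(transpose A *v y) \<bullet> x = y \<bullet> (A *v x)"
  by (metis dot_lmul_matrix vector_transpose_matrix transpose_transpose)

lemma inner_Gram_matrix_mult:
  fixes M :: "real^'n^'m"
  shows "((transpose M ** M) *v x) \<bullet> y = (M *v x) \<bullet> (M *v y)"
  by (metis matrix_vector_mul_assoc inner_transpose_matrix_vector_mult)

lemma norm_matrix_vector_mult_le_Frobenius:
  fixes A :: "real^'n^'m"
  shows "norm (A *v x) \<le> norm A * norm x"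
proof -
  have "norm (A *v x) = L2_set (\<lambda>i. \<bar>(A *v x) $ i\<bar>) UNIV"
    by (simp add: norm_vec_def)
  also have "\<dots> \<le> L2_set (\<lambda>i. norm (A $ i) * norm x) UNIV"
    by (intro L2_set_mono) (auto simp: matrix_vector_mul_component Cauchy_Schwarz_ineq2)
  also have "\<dots> = norm A * norm x"
    by (simp add: norm_vec_def[of A] L2_set_left_distrib)
  finally show ?thesis .
qed

section \<open>Rank-one matrices\<close>

definition outer :: "real^'m \<Rightarrow> real^'n \<Rightarrow> real^'n^'m"
  where "outer a y = (\<chi> i. a $ i *\<^sub>R y)"

text \<open>In the Frobenius inner product the matrix \<open>outer a y\<close> represents the
  functional sending \<open>A\<close> to \<open>a \<bullet> (A *v y)\<close>; the adjoint of the
  derivative is assembled from such matrices.\<close>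

lemma inner_outer_right: "A \<bullet> outer a y = a \<bullet> (A *v y)"
  by (simp add: outer_def inner_vec_def[of A] inner_vec_def[of a] matrix_vector_mul_component)

lemma outer_matrix_vector_mult: "outer a y *v z = (y \<bullet> z) *\<^sub>R a"
  by (simp add: outer_def vec_eq_iff matrix_vector_mul_component mult.commute)

lemma inner_outer_outer: "outer a y \<bullet> outer b z = (a \<bullet> b) * (y \<bullet> z)"
  by (simp add: inner_outer_right outer_matrix_vector_mult inner_commute)

lemma norm_outer: "norm (outer a y) = norm a * norm y"
  by (simp add: norm_eq_sqrt_inner inner_outer_outer real_sqrt_mult)

section \<open>Bordered vectors and matrices\<close>

lemma sum_UNIV_plus_1:
  fixes f :: "'n::finite + 1 \<Rightarrow> 'a::comm_monoid_add"
  shows "(\<Sum>k\<in>UNIV. f k) = (\<Sum>i\<in>UNIV. f (Inl i)) + f (Inr 1)"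
  by (simp add: UNIV_sum sum.union_disjoint sum.reindex image_iff disjoint_iff
      add.commute)

lemma snoc_vec_nth [simp]: "snoc_vec v c $ Inl j = v $ j" "snoc_vec v c $ Inr k = c"
  by (simp_all add: snoc_vec_def)

lemma vec_plus_1_eq_iff:
  fixes u :: "real^('n::finite + 1)"
  shows "u = w \<longleftrightarrow> (\<forall>i. u $ Inl i = w $ Inl i) \<and> u $ Inr 1 = w $ Inr 1"
  by (smt (verit) vec_eq_iff sum.exhaust num1_eq1)

lemma snoc_vec_eta:
  fixes u :: "real^('n::finite + 1)"
  shows "snoc_vec (\<chi> i. u $ Inl i) (u $ Inr 1) = u"
  by (simp add: vec_plus_1_eq_iff)

lemma inner_snoc_vec [simp]:
  fixes v w :: "real^'n::finite"
  shows "snoc_vec v c \<bullet> snoc_vec w d = v \<bullet> w + c * d"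
  by (simp add: inner_vec_def sum_UNIV_plus_1)

lemma norm_snoc_vec_sq:
  fixes v :: "real^'n::finite"
  shows "(norm (snoc_vec v c))\<^sup>2 = (norm v)\<^sup>2 + c\<^sup>2"
  by (simp only: power2_norm_eq_inner inner_snoc_vec) (simp add: power2_eq_square)

lemma snoc_col_mult_snoc_vec [simp]:
  fixes A :: "real^'n::finite^'m"
  shows "snoc_col A b *v snoc_vec y c = A *v y + c *\<^sub>R b"
  by (simp add: vec_eq_iff matrix_vector_mul_component snoc_col_def)

lemma scaleR_snoc_vec: "c *\<^sub>R snoc_vec v d = snoc_vec (c *\<^sub>R v) (c * d)"
  for v :: "real^'n::finite"
  by (simp add: vec_plus_1_eq_iff)

lemma snoc_col_outer: "snoc_col (outer a y) (c *\<^sub>R a) = outer a (snoc_vec y c)"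
  for y :: "real^'n::finite"
  by (simp add: fun_eq_iff snoc_col_def outer_def vec_plus_1_eq_iff)

lemma bounded_linear_snoc_col:
  "bounded_linear (\<lambda>p. snoc_col (fst p) (snd p) :: real^('n::finite + 1)^'m)"
  unfolding linear_conv_bounded_linear[symmetric]
  by (auto intro!: linearI simp: snoc_col_def vec_eq_iff[of "vec_lambda _"] vec_plus_1_eq_iff)

subsection \<open>Operator norms and derivatives\<close>

text \<open>The square of \<open>norm (f h)\<close> is \<open>h \<bullet> g (f h)\<close>, so
  Cauchy-Schwarz and the bound on \<open>g\<close> leave one factor \<open>norm (f h)\<close> to
  cancel.\<close>

lemma onorm_le_of_adjoint_le:
  fixes f :: "'a::real_inner \<Rightarrow> 'b::real_inner"
  assumes "\<And>h y. f h \<bullet> y = h \<bullet> g y" and "\<And>y. norm (g y) \<le> B * norm y" and "0 \<le> B"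
  shows "onorm f \<le> B"
proof (rule onorm_bound)
  fix h
  have "norm (f h) * norm (f h) \<le> norm h * norm (g (f h))"
    using assms(1)[of h "f h"] norm_cauchy_schwarz[of h "g (f h)"]
    by (simp add: power2_norm_eq_inner[symmetric] power2_eq_square)
  also have "\<dots> \<le> norm h * (B * norm (f h))"
    using assms(2) by (simp add: mult_left_mono)
  finally show "norm (f h) \<le> B * norm h"
    using assms(3) by (cases "f h = 0") (simp_all add: mult.assoc mult.left_commute)
qed (fact assms(3))

text \<open>Evaluating \<open>f\<close> at \<open>h = g y\<close> suffices. Every vector
  \<open>y\<close> thus yields a lower bound for the operator norm.\<close>

lemma norm_adjoint_le_onorm:
  fixes f :: "'a::real_inner \<Rightarrow> 'b::real_inner"
  assumes "bounded_linear f" "\<And>h y. f h \<bullet> y = h \<bullet> g y"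
  shows "norm (g y) \<le> onorm f * norm y"
proof (cases "g y = 0")
  case True
  then show ?thesis by (simp add: onorm_pos_le[OF assms(1)])
next
  case False
  have "norm (g y) * norm (g y) = f (g y) \<bullet> y"
    by (simp add: assms(2) power2_norm_eq_inner[symmetric] power2_eq_square)
  also have "\<dots> \<le> norm (f (g y)) * norm y" by (rule norm_cauchy_schwarz)
  also have "\<dots> \<le> (onorm f * norm (g y)) * norm y"
    by (intro mult_right_mono onorm assms) simp
  finally show ?thesis using False by (simp add: mult.assoc mult.left_commute)
qed

lemma matrix_inv_mult:
  fixes P :: "real^'n^'n"
  assumes "invertible P"
  shows "P ** matrix_inv P = mat 1" "matrix_inv P ** P = mat 1"
  using someI_ex[of "\<lambda>Q. P ** Q = mat 1 \<and> Q ** P = mat 1"] assms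
  by (simp_all add: invertible_def matrix_inv_def)

text \<open>Differentiability of the solution \<open>X\<close> is established first; the formula for
  its derivative then follows by differentiating \<open>P z *v X z = c z\<close> with the product
  rule and solving for the derivative of \<open>X\<close>.\<close>

lemma has_derivative_matrix_inv_mult:
  fixes P :: "'a::real_normed_vector \<Rightarrow> real^'n^'n" and c :: "'a \<Rightarrow> real^'n"
  assumes P: "(P has_derivative P') (at z)" and c: "(c has_derivative c') (at z)"
    and inv: "invertible (P z)"
  shows "((\<lambda>z. matrix_inv (P z) *v c z) has_derivative
    (\<lambda>h. matrix_inv (P z) *v (c' h - P' h *v (matrix_inv (P z) *v c z)))) (at z)"
proof -
  have entry: "(\<lambda>z. P z $ i $ j) differentiable at z" for i j
    using bounded_linear.has_derivative[OF bounded_linear_vec_nth[of j],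
        OF bounded_linear.has_derivative[OF bounded_linear_vec_nth[of i] P]]
    by (auto simp: differentiable_def)
  have centry: "(\<lambda>z. c z $ i) differentiable at z" for i
    using bounded_linear.has_derivative[OF bounded_linear_vec_nth[of i] c]
    by (auto simp: differentiable_def)
  have det: "(\<lambda>z. det (Q z)) differentiable at z"
    if "\<And>i j. (\<lambda>z. Q z $ i $ j) differentiable at z" for Q :: "'a \<Rightarrow> real^'n^'n"
  proof -
    have "(\<lambda>z. \<Prod>i\<in>UNIV. Q z $ i $ p i) differentiable at z" for p
      using has_derivative_prod[OF frechet_derivative_works[THEN iffD1, OF that],
          where I = UNIV and i3 = "\<lambda>i. i" and j3 = p]
      unfolding differentiable_def by blast
    then show ?thesis
      unfolding det_def by (intro differentiable_sum differentiable_mult) auto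
  qed
  \<comment> \<open>Continuity of the determinant keeps \<open>P y\<close> invertible near
    \<open>z\<close>, so identities valid for invertible \<open>P y\<close> hold on a
    neighbourhood.\<close>
  have "isCont (\<lambda>z. det (P z)) z"
    using det[OF entry] by (rule differentiable_imp_continuous_within)
  moreover have "det (P z) \<noteq> 0" using inv invertible_det_nz by blast
  ultimately have ev: "eventually (\<lambda>y. det (P y) \<noteq> 0) (at z)"
    by (simp add: isCont_def tendsto_imp_eventually_ne)
  have nz: "det (P z) \<noteq> 0" by fact
  define X where "X = (\<lambda>z. matrix_inv (P z) *v c z)"
  \<comment> \<open>Cramer's rule expresses the solution as a rational function of the entries.\<close>
  define Y where "Y = (\<lambda>z. \<chi> k. det (\<chi> i j. if j = k then c z $ i else P z $ i $ j) / det (P z))"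
  have PX: "P y *v X y = c y" and XY: "X y = Y y" if "det (P y) \<noteq> 0" for y
  proof -
    show *: "P y *v X y = c y"
      using that invertible_det_nz[of "P y"]
      by (simp add: X_def matrix_vector_mul_assoc matrix_inv_mult(1))
    show "X y = Y y" using * cramer[OF that, of "X y" "c y"] by (simp add: Y_def)
  qed
  have "(\<lambda>y. if j = k then c y $ i else P y $ i $ j) differentiable at z" for i j k
    by (cases "j = k") (simp_all add: entry centry)
  then have "(\<lambda>z. Y z $ k) differentiable at z" for k
    unfolding Y_def vec_lambda_beta
    by (intro differentiable_divide det nz) (simp_all add: entry)
  then have "Y differentiable at z"
    unfolding differentiable_componentwise_within[of Y]
    by (auto simp: Basis_vec_def inner_axis)
  then obtain Y' where Y': "(Y has_derivative Y') (at z)" by (auto simp: differentiable_def)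
  have X': "(X has_derivative Y') (at z)"
    using ev by (intro has_derivative_transform_eventually[OF Y'])
      (auto simp: XY nz elim: eventually_mono)
  have "((\<lambda>z. P z *v X z) has_derivative (\<lambda>h. P z *v Y' h + P' h *v X z)) (at z)"
    by (rule bounded_bilinear.FDERIV[OF bounded_bilinear_matrix_vector_mult P X'])
  moreover have "((\<lambda>z. P z *v X z) has_derivative c') (at z)"
    using ev by (intro has_derivative_transform_eventually[OF c])
      (auto simp: PX nz elim: eventually_mono)
  ultimately have eq: "(\<lambda>h. P z *v Y' h + P' h *v X z) = c'"
    by (rule has_derivative_unique)
  have "Y' = (\<lambda>h. matrix_inv (P z) *v (c' h - P' h *v X z))"
  proof
    fix h
    show "Y' h = matrix_inv (P z) *v (c' h - P' h *v X z)"
      using fun_cong[OF eq, of h] inv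
      by (simp add: eq_diff_eq[symmetric] matrix_vector_mul_assoc matrix_inv_mult(2) flip: eq)
  qed
  then show ?thesis using X' by (simp add: X_def)
qed

subsection \<open>The smallest singular value\<close>

lemma quadratic_nonneg_imp_linear_coeff_zero:
  fixes a b :: real
  assumes "\<And>t. 0 \<le> a * t\<^sup>2 + 2 * b * t"
  shows "b = 0"
proof (rule ccontr)
  assume "b \<noteq> 0"
  \<comment> \<open>Any positive \<open>c\<close> with \<open>a < 2 * c\<close> makes the quadratic
    negative at \<open>t = - b / c\<close>.\<close>
  define c where "c = \<bar>a\<bar> + 1"
  have c: "c > 0" "a < c" by (auto simp: c_def)
  have "a * (- b / c)\<^sup>2 + 2 * b * (- b / c) = (b / c)\<^sup>2 * (a - 2 * c)"
    using c by (simp add: field_simps power2_eq_square)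
  also have "\<dots> < 0"
    using c \<open>b \<noteq> 0\<close> by (intro mult_pos_neg) auto
  finally show False using assms[of "- b / c"] by simp
qed

lemma norm_add_sq: "(norm (x + y))\<^sup>2 = (norm x)\<^sup>2 + 2 * (x \<bullet> y) + (norm y)\<^sup>2"
  for x y :: "'a::real_inner"
  by (simp add: power2_norm_eq_inner inner_simps inner_commute)

text \<open>The norm of \<open>M *v u\<close> attains its minimum on the compact unit sphere. The
  first-order condition makes a minimiser an eigenvector of the Gram matrix, and evaluation at the
  eigenvector of any other singular value shows that the minimum is the least one.\<close>

lemma smallest_singular_value_attained:
  fixes M :: "real^'k^'m"
  obtains v where "norm v = 1" "norm (M *v v) = smallest_singular_value M"
    "\<And>u. smallest_singular_value M * norm u \<le> norm (M *v u)"
proof -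
  have "sphere (0::real^'k) 1 \<noteq> {}"
    using vector_choose_size[of 1] by (auto simp: dist_norm)
  then obtain v where v: "v \<in> sphere 0 1"
      "\<And>u. u \<in> sphere 0 1 \<Longrightarrow> norm (M *v v) \<le> norm (M *v u)"
    using continuous_attains_inf[of "sphere (0::real^'k) 1" "\<lambda>u. norm (M *v u)"]
    by (metis compact_sphere continuous_on_norm matrix_vector_mult_linear_continuous_on)
  define \<mu> where "\<mu> = norm (M *v v)"
  have nv: "norm v = 1" using v by simp
  have le: "\<mu> * norm u \<le> norm (M *v u)" for u
  proof (cases "u = 0")
    case False
    then have "\<mu> \<le> norm (M *v ((1 / norm u) *\<^sub>R u))"
      unfolding \<mu>_def by (intro v(2)) simp
    then show ?thesis using False by (simp add: matrix_vector_mult_scaleR field_simps)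
  qed simp
  have eigen: "(transpose M ** M) *v v = \<mu>\<^sup>2 *\<^sub>R v"
  proof (rule vector_eq_rdot[THEN iffD1], rule allI)
    fix y
    \<comment> \<open>Half the derivative at \<open>t = 0\<close> of the squared norm of
      \<open>M *v (v + t *\<^sub>R y)\<close> minus \<open>\<mu>\<^sup>2\<close> times that of
      \<open>v + t *\<^sub>R y\<close>. This function is nonnegative and vanishes at
      \<open>t = 0\<close>, so \<open>e = 0\<close>.\<close>
    define e where "e = (M *v v) \<bullet> (M *v y) - \<mu>\<^sup>2 * (v \<bullet> y)"
    have "0 \<le> ((norm (M *v y))\<^sup>2 - \<mu>\<^sup>2 * (norm y)\<^sup>2) * t\<^sup>2 + 2 * e * t" for t
    proof -
      have "(\<mu> * norm (v + t *\<^sub>R y))\<^sup>2 \<le> (norm (M *v (v + t *\<^sub>R y)))\<^sup>2"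
        by (intro power_mono le) (simp add: \<mu>_def)
      then show ?thesis
        using nv by (simp add: e_def \<mu>_def matrix_vector_right_distrib matrix_vector_mult_scaleR
            norm_add_sq power_mult_distrib algebra_simps)
    qed
    then have "e = 0" by (rule quadratic_nonneg_imp_linear_coeff_zero)
    then show "((transpose M ** M) *v v) \<bullet> y = (\<mu>\<^sup>2 *\<^sub>R v) \<bullet> y"
      by (simp add: e_def inner_Gram_matrix_mult)
  qed
  have "smallest_singular_value M = \<mu>"
    unfolding smallest_singular_value_def
  proof (rule Least_equality)
    show "singular_value M \<mu>"
      unfolding singular_value_def using eigen nv by (auto simp: \<mu>_def intro!: exI[of _ v])
  next
    fix s assume "singular_value M s"
    then obtain w where w: "0 \<le> s" "w \<noteq> 0" "(transpose M ** M) *v w = s\<^sup>2 *\<^sub>R w"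
      by (auto simp: singular_value_def)
    have "(M *v w) \<bullet> (M *v w) = ((transpose M ** M) *v w) \<bullet> w"
      by (simp add: inner_Gram_matrix_mult)
    then have "(norm (M *v w))\<^sup>2 = (s * norm w)\<^sup>2"
      using w(3) by (simp add: power2_norm_eq_inner power_mult_distrib)
    then have "norm (M *v w) = s * norm w"
      using w(1) by (simp add: power2_eq_iff_nonneg)
    then show "\<mu> \<le> s" using le[of w] w(2) by simp
  qed
  then show ?thesis using that nv le by (simp add: \<mu>_def)
qed

lemma smallest_singular_value_nonneg: "0 \<le> smallest_singular_value M"
  for M :: "real^'k^'m"
  by (rule smallest_singular_value_attained[of M]) (metis norm_ge_zero)

lemma smallest_singular_value_le:
  fixes M :: "real^'k^'m"
  shows "smallest_singular_value M * norm u \<le> norm (M *v u)"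
  by (rule smallest_singular_value_attained[of M]) blast

lemma has_derivative_of_quadratic_remainder:
  fixes f :: "'a::real_normed_vector \<Rightarrow> 'b::real_normed_vector"
  assumes "bounded_linear f'" and "\<And>h. norm (f (z + h) - f z - f' h) \<le> C * (norm h)\<^sup>2"
  shows "(f has_derivative f') (at z)"
  unfolding has_derivative_at
proof (intro conjI assms(1))
  have lim: "((\<lambda>h. C * norm (h::'a)) \<longlongrightarrow> 0) (at 0)"
    by (intro tendsto_mult_right_zero tendsto_norm_zero tendsto_ident_at)
  have "norm (f (z + h) - f z - f' h) / norm h \<le> C * norm h" if "h \<noteq> 0" for h
    using assms(2)[of h] that by (simp add: field_simps power2_eq_square)
  then show "((\<lambda>h. norm (f (z + h) - f z - f' h) / norm h) \<longlongrightarrow> 0) (at 0)"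
    by (intro tendsto_sandwich[OF _ _ tendsto_const lim])
      (auto simp: eventually_at_filter)
qed

text \<open>The hypothesis \<open>gap\<close> says that \<open>\<mu>\<close> is a simple smallest
  eigenvalue of the Gram matrix, with unit eigenvector \<open>v\<close> and spectral gap at least
  \<open>\<gamma>\<close>. Testing the perturbed matrix with \<open>v\<close> bounds the perturbed
  eigenvalue from above. For the lower bound the gap penalises the distance of the perturbed
  minimiser from \<open>v\<close>.\<close>

lemma smallest_singular_value_sq_has_derivative:
  fixes M :: "real^'k^'m" and v :: "real^'k"
  assumes nv: "norm v = 1" and \<gamma>: "0 < \<gamma>"
    and Mv: "(norm (M *v v))\<^sup>2 = \<mu>"
    and gap: "\<And>u. \<mu> * (norm u)\<^sup>2 + \<gamma> * ((norm u)\<^sup>2 - (v \<bullet> u)\<^sup>2) \<le> (norm (M *v u))\<^sup>2"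
  shows "smallest_singular_value M = norm (M *v v)"
    and "((\<lambda>M. (smallest_singular_value M)\<^sup>2) has_derivative
      (\<lambda>D. 2 * ((M *v v) \<bullet> (D *v v)))) (at M)"
proof -
  have cs: "(v \<bullet> u)\<^sup>2 \<le> (norm u)\<^sup>2" for u
    using Cauchy_Schwarz_ineq2[of v u] nv by (simp add: abs_le_square_iff[symmetric])
  have ge: "\<mu> * (norm u)\<^sup>2 \<le> (norm (M *v u))\<^sup>2" for u
    using gap[of u] cs[of u] \<gamma> by (smt (verit) mult_nonneg_nonneg)
  obtain v0 where v0: "norm v0 = 1" "norm (M *v v0) = smallest_singular_value M"
    by (rule smallest_singular_value_attained[of M])
  have "norm (M *v v) \<le> smallest_singular_value M"
    using ge[of v0] v0 Mv
    by (intro power2_le_imp_le[OF _ smallest_singular_value_nonneg]) simp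
  then show eq: "smallest_singular_value M = norm (M *v v)"
    using smallest_singular_value_le[of M v] nv by simp
  define K where "K = norm M"
  show "((\<lambda>M. (smallest_singular_value M)\<^sup>2) has_derivative
      (\<lambda>D. 2 * ((M *v v) \<bullet> (D *v v)))) (at M)"
  \<comment> \<open>The summand 1 comes from the upper bound,
    \<open>8 * K\<^sup>2 / \<gamma>\<close> from completing a square in the lower bound.\<close>
  proof (rule has_derivative_of_quadratic_remainder[where C = "1 + 8 * K\<^sup>2 / \<gamma>"])
    show "bounded_linear (\<lambda>D. 2 * ((M *v v) \<bullet> (D *v v)))"
      by (intro bounded_linear_const_mult
          bounded_linear_compose[OF bounded_linear_inner_right]
          bounded_bilinear.bounded_linear_left[OF bounded_bilinear_matrix_vector_mult])
  next
    fix D :: "real^'k^'m"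
    define \<delta> where "\<delta> = norm D"
    define S where "S = (smallest_singular_value (M + D))\<^sup>2"
    define L where "L = (M *v v) \<bullet> (D *v v)"
    have expand: "(norm ((M + D) *v u))\<^sup>2
        = (norm (M *v u))\<^sup>2 + 2 * ((M *v u) \<bullet> (D *v u)) + (norm (D *v u))\<^sup>2" for u
      by (simp add: matrix_vector_mult_add_rdistrib norm_add_sq)
    have "S \<le> (norm ((M + D) *v v))\<^sup>2"
      using smallest_singular_value_le[of "M + D" v] nv smallest_singular_value_nonneg[of "M + D"]
      by (simp add: S_def power_mono)
    also have "\<dots> \<le> \<mu> + 2 * L + \<delta>\<^sup>2"
      using norm_matrix_vector_mult_le_Frobenius[of D v] nv
      by (simp add: expand Mv L_def \<delta>_def power_mono)
    finally have upper: "S - \<mu> - 2 * L \<le> \<delta>\<^sup>2" by simp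
    obtain u0 where u0: "norm u0 = 1" "norm ((M + D) *v u0) = smallest_singular_value (M + D)"
      by (rule smallest_singular_value_attained[of "M + D"])
    \<comment> \<open>The sign of the minimiser is chosen so that \<open>v \<bullet> u\<close> lies
      between 0 and 1; then \<open>(v \<bullet> u)\<^sup>2 \<le> v \<bullet> u\<close>, and the gap
      controls \<open>e\<^sup>2\<close>.\<close>
    define u where "u = (if v \<bullet> u0 \<ge> 0 then u0 else - u0)"
    have u: "norm u = 1" "norm ((M + D) *v u) = smallest_singular_value (M + D)" "0 \<le> v \<bullet> u"
      using u0 by (auto simp: u_def linear_neg[OF matrix_vector_mul_linear])
    define e where "e = norm (u - v)"
    have c1: "v \<bullet> u \<le> 1" using norm_cauchy_schwarz[of v u] nv u by simp
    have "(v \<bullet> u)\<^sup>2 \<le> v \<bullet> u"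
      using u(3) c1 by (simp add: power2_eq_square mult_left_le)
    moreover have "e\<^sup>2 = 2 - 2 * (v \<bullet> u)"
      using nv u(1) by (simp add: e_def power2_norm_eq_inner inner_simps inner_commute norm_eq_1)
    ultimately have e2: "e\<^sup>2 / 2 \<le> 1 - (v \<bullet> u)\<^sup>2" by simp
    have "(M *v u) \<bullet> (D *v u) - L = (M *v (u - v)) \<bullet> (D *v u) + (M *v v) \<bullet> (D *v (u - v))"
      by (simp add: L_def matrix_vector_mult_diff_distrib inner_simps)
    moreover have "- ((K * e) * \<delta>) \<le> (M *v (u - v)) \<bullet> (D *v u)"
    proof -
      have "\<bar>(M *v (u - v)) \<bullet> (D *v u)\<bar> \<le> norm (M *v (u - v)) * norm (D *v u)"
        by (rule Cauchy_Schwarz_ineq2)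
      also have "\<dots> \<le> (K * e) * \<delta>"
        using norm_matrix_vector_mult_le_Frobenius[of M "u - v"]
          norm_matrix_vector_mult_le_Frobenius[of D u] u(1)
        by (intro mult_mono) (auto simp: K_def e_def \<delta>_def)
      finally show ?thesis by simp
    qed
    moreover have "- (K * (\<delta> * e)) \<le> (M *v v) \<bullet> (D *v (u - v))"
    proof -
      have "\<bar>(M *v v) \<bullet> (D *v (u - v))\<bar> \<le> norm (M *v v) * norm (D *v (u - v))"
        by (rule Cauchy_Schwarz_ineq2)
      also have "\<dots> \<le> K * (\<delta> * e)"
        using norm_matrix_vector_mult_le_Frobenius[of M v]
          norm_matrix_vector_mult_le_Frobenius[of D "u - v"] nv
        by (intro mult_mono) (auto simp: K_def e_def \<delta>_def)
      finally show ?thesis by simp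
    qed
    ultimately have cross: "L - 2 * (K * \<delta> * e) \<le> (M *v u) \<bullet> (D *v u)"
      by (simp add: algebra_simps)
    \<comment> \<open>Completing the square absorbs the cross term, which is linear in
      \<open>e\<close>, into the gap term, leaving only a multiple of
      \<open>\<delta>\<^sup>2\<close>.\<close>
    have "0 \<le> \<gamma> / 2 * (e - 4 * K * \<delta> / \<gamma>)\<^sup>2" using \<gamma> by simp
    also have "\<dots> = \<gamma> * (e\<^sup>2 / 2) - 4 * (K * \<delta> * e) + 8 * K\<^sup>2 / \<gamma> * \<delta>\<^sup>2"
      using \<gamma> by (simp add: field_simps power2_eq_square)
    also have "\<dots> \<le> \<gamma> * (1 - (v \<bullet> u)\<^sup>2) - 4 * (K * \<delta> * e) + 8 * K\<^sup>2 / \<gamma> * \<delta>\<^sup>2"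
      using e2 \<gamma> by (simp add: mult_left_mono)
    also have "\<gamma> * (1 - (v \<bullet> u)\<^sup>2) \<le> (norm (M *v u))\<^sup>2 - \<mu>"
      using gap[of u] u(1) by simp
    also have "\<dots> \<le> S - \<mu> - 2 * ((M *v u) \<bullet> (D *v u))"
      using expand[of u] u(2) by (simp add: S_def)
    finally have lower: "- (8 * K\<^sup>2 / \<gamma> * \<delta>\<^sup>2) \<le> S - \<mu> - 2 * L"
      using cross by simp
    have "0 \<le> 8 * K\<^sup>2 / \<gamma> * \<delta>\<^sup>2" "0 \<le> \<delta>\<^sup>2" using \<gamma> by auto
    then have "\<bar>S - \<mu> - 2 * L\<bar> \<le> (1 + 8 * K\<^sup>2 / \<gamma>) * \<delta>\<^sup>2"
      using upper lower unfolding distrib_right mult_1 by linarith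
    then show "norm ((smallest_singular_value (M + D))\<^sup>2 - (smallest_singular_value M)\<^sup>2
        - 2 * ((M *v v) \<bullet> (D *v v))) \<le> (1 + 8 * K\<^sup>2 / \<gamma>) * (norm D)\<^sup>2"
      by (simp add: S_def L_def \<delta>_def eq Mv)
  qed
qed

subsection \<open>The derivative of the TLS solution map\<close>

locale tls_svd =
  fixes A :: "real^('n::{finite,linorder})^'m" and b :: "real^'m"
    and x \<beta> :: "real^('n::{finite,linorder})"
    and U :: "real^('n + 1)^'m" and \<sigma> :: "real^('n + 1)"
    and V :: "real^('n + 1)^('n + 1)" and \<alpha> :: real
  assumes svd: "thin_svd (snoc_col A b) U \<sigma> V"
    and \<sigma>_pos: "0 < \<sigma> $ Inr 1"
    and sep: "\<sigma> $ Inr 1 < smallest_singular_value A"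
    and sol: "tls_solution A b x"
    and \<alpha>_eq: "\<alpha> = 1 / sqrt (1 + (norm x)\<^sup>2)"
    and last_row: "row (Inr 1) V = snoc_vec \<beta> (- \<alpha>)"
begin

abbreviation "M \<equiv> snoc_col A b"
abbreviation "s \<equiv> \<sigma> $ Inr 1"
abbreviation "v k \<equiv> column k V"

definition w :: "'n \<Rightarrow> real^('n::_)" where "w i = (\<chi> j. V $ Inl j $ Inl i)"

definition d :: "'n \<Rightarrow> real" where "d i = (\<sigma> $ Inl i)\<^sup>2 - s\<^sup>2"

section \<open>Orthogonality of \<open>V\<close> and the spectral expansion of the data
  matrix\<close>

lemma \<alpha>_pos: "0 < \<alpha>"
  unfolding \<alpha>_eq by (simp add: add_pos_nonneg)

lemma \<alpha>_sq: "\<alpha>\<^sup>2 * (1 + x \<bullet> x) = 1"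
proof -
  have "0 < 1 + (norm x)\<^sup>2" by (simp add: add_pos_nonneg)
  then show ?thesis by (simp add: \<alpha>_eq power_divide power2_norm_eq_inner)
qed

lemma one_plus_x: "1 + x \<bullet> x = 1 / \<alpha>\<^sup>2"
  using \<alpha>_sq \<alpha>_pos by (simp add: field_simps)

lemma inner_v_eq: "v k \<bullet> u = (transpose V *v u) $ k"
  by (simp add: matrix_vector_mul_component row_transpose[symmetric] row_def column_def transpose_def)

lemma inner_v_v: "v k \<bullet> v l = (if k = l then 1 else 0)"
proof -
  have "(transpose V ** V) $ k $ l = (if k = l then 1 else 0)"
    using svd by (simp add: thin_svd_def mat_def)
  then show ?thesis
    by (simp add: matrix_matrix_mult_def transpose_def column_def inner_vec_def)
qed

lemma V_transpose_V: "V ** transpose V = mat 1"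
  using svd matrix_left_right_inverse by (auto simp: thin_svd_def)

lemma Parseval: "(\<Sum>k\<in>UNIV. (v k \<bullet> u) * (v k \<bullet> u')) = u \<bullet> u'"
proof -
  have "(\<Sum>k\<in>UNIV. (v k \<bullet> u) * (v k \<bullet> u')) = (transpose V *v u) \<bullet> (transpose V *v u')"
    unfolding inner_v_eq inner_vec_def[of "transpose V *v u"] by simp
  also have "\<dots> = u \<bullet> u'"
    by (simp only: inner_transpose_matrix_vector_mult matrix_vector_mul_assoc V_transpose_V
        matrix_vector_mul_lid)
  finally show ?thesis .
qed

text \<open>The SVD in bilinear form: \<open>U\<close> drops out because its columns are
  orthonormal. Vectors with last entry 0 turn this into an expansion for \<open>A\<close>.\<close>

lemma inner_M: "(M *v u) \<bullet> (M *v u') = (\<Sum>k\<in>UNIV. (\<sigma> $ k)\<^sup>2 * ((v k \<bullet> u) * (v k \<bullet> u')))"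
proof -
  have M: "M *v u = U *v (diag \<sigma> *v (transpose V *v u))" for u
    using svd by (simp only: thin_svd_def matrix_vector_mul_assoc matrix_mul_assoc)
  have U: "(U *v z) \<bullet> (U *v z') = z \<bullet> z'" for z z'
    using svd inner_Gram_matrix_mult[of U z z'] by (simp add: thin_svd_def)
  have diag: "(diag \<sigma> *v z) $ k = \<sigma> $ k * z $ k" for z k
  proof -
    have "(diag \<sigma> *v z) $ k = (\<Sum>j\<in>UNIV. if j = k then \<sigma> $ k * z $ k else 0)"
      unfolding matrix_vector_mult_def diag_def vec_lambda_beta by (rule sum.cong) auto
    then show ?thesis by simp
  qed
  show ?thesis
    unfolding M U inner_v_eq unfolding inner_vec_def diag inner_real_def
    by (intro sum.cong) (auto simp: power2_eq_square)
qed

lemma v_Inl: "v (Inl i) = snoc_vec (w i) (\<beta> $ i)"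
  using arg_cong[OF last_row, of "\<lambda>r. r $ Inl i"]
  by (simp add: vec_plus_1_eq_iff column_def row_def w_def)

lemma v_Inr_nth: "v (Inr 1) $ Inr 1 = - \<alpha>"
  using arg_cong[OF last_row, of "\<lambda>r. r $ Inr 1"] by (simp add: column_def row_def)

text \<open>Equality would make the eigenspace of \<open>s\<^sup>2\<close> at least two-dimensional,
  hence give it a nonzero vector with last entry 0. Its first part \<open>y\<close> would satisfy
  \<open>norm (A *v y) = s * norm y\<close>, against the separation hypothesis.\<close>

lemma \<sigma>_less: "s < \<sigma> $ Inl i"
proof (rule ccontr)
  assume "\<not> s < \<sigma> $ Inl i"
  moreover have "s \<le> \<sigma> $ Inl i" using svd by (simp add: thin_svd_def)
  ultimately have eq: "\<sigma> $ Inl i = s" by simp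
  \<comment> \<open>a vector of the eigenspace of \<open>s\<^sup>2\<close> whose last entry vanishes\<close>
  define u where "u = \<alpha> *\<^sub>R v (Inl i) + \<beta> $ i *\<^sub>R v (Inr 1)"
  have vu: "v k \<bullet> u = (if k = Inl i then \<alpha> else if k = Inr 1 then \<beta> $ i else 0)" for k
    by (simp add: u_def inner_simps inner_v_v)
  have "u $ Inr 1 = 0"
    using v_Inr_nth by (simp add: u_def v_Inl)
  then obtain y where y: "u = snoc_vec y 0" by (metis snoc_vec_eta)
  have "(M *v u) \<bullet> (M *v u) = (\<Sum>k\<in>UNIV. s\<^sup>2 * ((v k \<bullet> u) * (v k \<bullet> u)))"
    unfolding inner_M by (intro sum.cong) (auto simp: vu eq)
  also have "\<dots> = s\<^sup>2 * (u \<bullet> u)"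
    by (simp only: sum_distrib_left[symmetric] Parseval)
  finally have "(norm (A *v y))\<^sup>2 = (s * norm y)\<^sup>2"
    by (simp add: y power2_norm_eq_inner power_mult_distrib)
  then have "norm (A *v y) = s * norm y"
    using \<sigma>_pos by (simp add: power2_eq_iff_nonneg)
  moreover have "y \<noteq> 0"
  proof
    assume "y = 0"
    then have "v (Inl i) \<bullet> u = 0" by (simp add: y v_Inl)
    then show False using vu[of "Inl i"] \<alpha>_pos by simp
  qed
  ultimately show False
    using smallest_singular_value_le[of A y] sep by simp
qed

lemma d_pos: "0 < d i"
  using \<sigma>_less[of i] \<sigma>_pos by (simp add: d_def power_strict_mono)

section \<open>The last right singular vector and the TLS solution\<close>

lemma norm_M_last: "(norm (M *v v (Inr 1)))\<^sup>2 = s\<^sup>2"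
proof -
  have "(norm (M *v v (Inr 1)))\<^sup>2 = (\<Sum>k\<in>(UNIV :: ('n + 1) set). if k = Inr 1 then s\<^sup>2 else 0)"
    unfolding power2_norm_eq_inner inner_M inner_v_v by (intro sum.cong) auto
  then show ?thesis by simp
qed

text \<open>Expanding in the columns of \<open>V\<close>, the least of the positive numbers
  \<open>d i\<close> serves as the gap.\<close>

lemma spectral_gap:
  obtains \<gamma> where "0 < \<gamma>"
    "\<And>u. s\<^sup>2 * (norm u)\<^sup>2 + \<gamma> * ((norm u)\<^sup>2 - (v (Inr 1) \<bullet> u)\<^sup>2) \<le> (norm (M *v u))\<^sup>2"
proof
  show "0 < Min (range d)" using d_pos by simp
  fix u
  define c where "c i = (v (Inl i) \<bullet> u)\<^sup>2" for i
  have u: "(norm u)\<^sup>2 = (\<Sum>i\<in>UNIV. c i) + (v (Inr 1) \<bullet> u)\<^sup>2"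
    unfolding power2_norm_eq_inner Parseval[of u u, symmetric] sum_UNIV_plus_1
    by (simp add: c_def power2_eq_square)
  have "Min (range d) * (\<Sum>i\<in>UNIV. c i) \<le> (\<Sum>i\<in>UNIV. d i * c i)"
    unfolding sum_distrib_left by (intro sum_mono mult_right_mono) (auto simp: c_def)
  also have "\<dots> = (\<Sum>i\<in>UNIV. (\<sigma> $ Inl i)\<^sup>2 * c i) - s\<^sup>2 * (\<Sum>i\<in>UNIV. c i)"
    by (simp add: d_def left_diff_distrib sum_subtractf sum_distrib_left)
  also have "\<dots> = (norm (M *v u))\<^sup>2 - s\<^sup>2 * (norm u)\<^sup>2"
    unfolding u unfolding power2_norm_eq_inner inner_M sum_UNIV_plus_1
    by (simp add: c_def power2_eq_square algebra_simps)
  finally show "s\<^sup>2 * (norm u)\<^sup>2 + Min (range d) * ((norm u)\<^sup>2 - (v (Inr 1) \<bullet> u)\<^sup>2)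
      \<le> (norm (M *v u))\<^sup>2"
    by (simp add: u)
qed

text \<open>
  Compares the optimal correction with the rank-one correction read off from the last right singular
  vector, whose Frobenius norm is \<open>s\<close>.
\<close>

lemma residual_le: "(norm (M *v snoc_vec x (- 1)))\<^sup>2 \<le> s\<^sup>2 * (norm (snoc_vec x (- 1)))\<^sup>2"
proof -
  obtain E r where E: "(A + E) *v x = b - r"
    and min: "\<And>E' r'. tls_feasible A b E' r' \<Longrightarrow> norm (snoc_col E r) \<le> norm (snoc_col E' r')"
    using sol unfolding tls_solution_def by blast
  \<comment> \<open>The last column of \<open>V\<close> is \<open>\<alpha>\<close> times
    \<open>(y, -1)\<close>; that \<open>y\<close> equals \<open>x\<close> is not yet known.\<close>
  define y where "y = (1 / \<alpha>) *\<^sub>R ((\<chi> i. v (Inr 1) $ Inl i) :: real^('n::_))"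
  have v: "v (Inr 1) = (- \<alpha>) *\<^sub>R snoc_vec (- y) 1"
    using \<alpha>_pos v_Inr_nth by (simp add: vec_plus_1_eq_iff y_def)
  have "(norm (v (Inr 1)))\<^sup>2 = 1" by (simp add: power2_norm_eq_inner inner_v_v)
  then have ny: "\<alpha>\<^sup>2 * (1 + (norm y)\<^sup>2) = 1"
    unfolding v norm_scaleR power_mult_distrib norm_snoc_vec_sq by (simp add: add.commute)
  have "(norm (M *v v (Inr 1)))\<^sup>2 = \<alpha>\<^sup>2 * (norm (b - A *v y))\<^sup>2"
    unfolding v matrix_vector_mult_scaleR norm_scaleR power_mult_distrib snoc_col_mult_snoc_vec
    by (simp add: linear_neg[OF matrix_vector_mul_linear])
  then have res: "\<alpha> * norm (b - A *v y) = s"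
    using norm_M_last \<sigma>_pos \<alpha>_pos by (simp add: power2_eq_iff_nonneg flip: power_mult_distrib)
  \<comment> \<open>The scaling is forced: \<open>(A + outer e y) *v y = b - e\<close> means that
    \<open>1 + y \<bullet> y\<close>, which is \<open>1 / \<alpha>\<^sup>2\<close>, times
    \<open>e\<close> equals \<open>b - A *v y\<close>.\<close>
  define e where "e = \<alpha>\<^sup>2 *\<^sub>R (b - A *v y)"
  have "(A + outer e y) *v y = b - e"
  proof -
    have "(y \<bullet> y + 1) *\<^sub>R e = b - A *v y"
      using ny by (simp add: e_def power2_norm_eq_inner algebra_simps flip: scaleR_add_left)
    then show ?thesis
      by (simp add: matrix_vector_mult_add_rdistrib outer_matrix_vector_mult algebra_simps)
  qed
  then have "tls_feasible A b (outer e y) e"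
    unfolding tls_feasible_def by (metis rangeI)
  then have "norm (snoc_col E r) \<le> norm (snoc_col (outer e y) (1 *\<^sub>R e))"
    using min by simp
  also have "\<dots> = norm e * norm (snoc_vec y 1)"
    by (simp only: snoc_col_outer norm_outer)
  also have "\<dots> = s"
  proof -
    have "\<alpha> * norm (snoc_vec y 1) = 1"
    proof (rule power2_eq_imp_eq)
      show "(\<alpha> * norm (snoc_vec y 1))\<^sup>2 = 1\<^sup>2"
        using ny by (simp add: power_mult_distrib norm_snoc_vec_sq add.commute)
    qed (use \<alpha>_pos in auto)
    then show ?thesis
      using res \<alpha>_pos by (simp add: e_def power2_eq_square mult.assoc mult.left_commute)
  qed
  finally have le: "norm (snoc_col E r) \<le> s" .
  \<comment> \<open>Since \<open>r\<close> is subtracted from \<open>b\<close> but \<open>E\<close>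
    is added to \<open>A\<close>, the border entry changes sign; \<open>(x, 1)\<close> and
    \<open>(x, -1)\<close> have the same norm.\<close>
  have "M *v snoc_vec x (- 1) = - (snoc_col E r *v snoc_vec x 1)"
    using E by (simp add: matrix_vector_mult_add_rdistrib algebra_simps)
  then have "norm (M *v snoc_vec x (- 1)) \<le> norm (snoc_col E r) * norm (snoc_vec x 1)"
    by (simp only: norm_minus_cancel norm_matrix_vector_mult_le_Frobenius)
  also have "\<dots> \<le> s * norm (snoc_vec x 1)"
    by (intro mult_right_mono le) simp
  finally have "(norm (M *v snoc_vec x (- 1)))\<^sup>2 \<le> (s * norm (snoc_vec x 1))\<^sup>2"
    by (intro power_mono) auto
  then show ?thesis by (simp add: power_mult_distrib norm_snoc_vec_sq)
qed

text \<open>By \<open>residual_le\<close> and the spectral gap, \<open>(x, -1)\<close> has no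
  component orthogonal to the last column of \<open>V\<close>. The last entry
  \<open>- \<alpha>\<close> then fixes the factor.\<close>

lemma v_Inr: "v (Inr 1) = snoc_vec (\<alpha> *\<^sub>R x) (- \<alpha>)"
proof -
  obtain \<gamma> where \<gamma>: "0 < \<gamma>"
    "\<And>u. s\<^sup>2 * (norm u)\<^sup>2 + \<gamma> * ((norm u)\<^sup>2 - (v (Inr 1) \<bullet> u)\<^sup>2) \<le> (norm (M *v u))\<^sup>2"
    by (rule spectral_gap) blast
  define u where "u = snoc_vec x (- 1)"
  define c where "c = v (Inr 1) \<bullet> u"
  have "\<gamma> * ((norm u)\<^sup>2 - c\<^sup>2) \<le> 0"
    using \<gamma>(2)[of u] residual_le by (simp add: u_def c_def)
  then have "(norm u)\<^sup>2 - c\<^sup>2 \<le> 0"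
    using \<gamma>(1) by (simp add: mult_le_0_iff)
  moreover have "(norm (u - c *\<^sub>R v (Inr 1)))\<^sup>2 = (norm u)\<^sup>2 - c\<^sup>2"
    unfolding power2_norm_eq_inner
    by (simp add: inner_simps inner_v_v c_def inner_commute power2_eq_square)
  ultimately have "(norm (u - c *\<^sub>R v (Inr 1)))\<^sup>2 \<le> 0" by simp
  then have u: "u = c *\<^sub>R v (Inr 1)" by simp
  have "c * \<alpha> = 1"
    using arg_cong[OF u, of "\<lambda>z. z $ Inr 1"] v_Inr_nth by (simp add: u_def)
  then have "v (Inr 1) = \<alpha> *\<^sub>R u" by (simp add: u mult.commute)
  then show ?thesis by (simp add: u_def scaleR_snoc_vec)
qed

section \<open>Spectral expansions in the first \<open>n\<close> coordinates\<close>

lemma inner_w_w: "w i \<bullet> w j = (if i = j then 1 else 0) - \<beta> $ i * \<beta> $ j"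
  using inner_v_v[of "Inl i" "Inl j"] by (simp add: v_Inl)

lemma inner_w_x: "w i \<bullet> x = \<beta> $ i"
  using inner_v_v[of "Inl i" "Inr 1"] \<alpha>_pos by (simp add: v_Inl v_Inr)

lemma sum_\<beta>: "(\<Sum>i\<in>UNIV. (\<beta> $ i)\<^sup>2) = 1 - \<alpha>\<^sup>2"
  using Parseval[of "snoc_vec 0 1" "snoc_vec 0 1"]
  by (simp add: sum_UNIV_plus_1 v_Inl v_Inr power2_eq_square)

text \<open>Parseval for vectors bordered by 0; the term with \<open>x\<close> is the contribution
  of the last column of \<open>V\<close>.\<close>

lemma Parseval_w: "(\<Sum>i\<in>UNIV. (w i \<bullet> y) * (w i \<bullet> y')) + \<alpha>\<^sup>2 * ((x \<bullet> y) * (x \<bullet> y')) = y \<bullet> y'"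
  using Parseval[of "snoc_vec y 0" "snoc_vec y' 0"]
  by (simp add: sum_UNIV_plus_1 v_Inl v_Inr power2_eq_square mult_ac)

lemma inner_A: "(A *v y) \<bullet> (A *v y') =
    (\<Sum>i\<in>UNIV. (\<sigma> $ Inl i)\<^sup>2 * ((w i \<bullet> y) * (w i \<bullet> y'))) + s\<^sup>2 * \<alpha>\<^sup>2 * ((x \<bullet> y) * (x \<bullet> y'))"
  using inner_M[of "snoc_vec y 0" "snoc_vec y' 0"]
  by (simp add: sum_UNIV_plus_1 v_Inl v_Inr power2_eq_square mult_ac)

definition \<rho> :: "real^'m" where "\<rho> = b - A *v x"

lemma \<rho>_eq: "\<rho> = (- 1 / \<alpha>) *\<^sub>R (M *v v (Inr 1))"
  using \<alpha>_pos by (simp add: \<rho>_def v_Inr matrix_vector_mult_scaleR scaleR_diff_right)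

lemma inner_M_last: "(M *v v (Inr 1)) \<bullet> (M *v u) = s\<^sup>2 * (v (Inr 1) \<bullet> u)"
proof -
  have "(M *v v (Inr 1)) \<bullet> (M *v u)
      = (\<Sum>k\<in>(UNIV :: ('n + 1) set). if k = Inr 1 then s\<^sup>2 * (v (Inr 1) \<bullet> u) else 0)"
    unfolding inner_M inner_v_v by (intro sum.cong) auto
  then show ?thesis by simp
qed

text \<open>The residual is a multiple of the image of the last singular vector, so the eigenvector
  equation yields \<open>- s\<^sup>2 *\<^sub>R x\<close> as the image of \<open>\<rho>\<close> under
  the transpose of \<open>A\<close>. The normal equation \<open>P_x\<close> is a rearrangement of
  this.\<close>

lemma inner_\<rho>_A: "\<rho> \<bullet> (A *v y) = - s\<^sup>2 * (x \<bullet> y)"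
  using inner_M_last[of "snoc_vec y 0"] \<alpha>_pos by (simp add: \<rho>_eq v_Inr)

lemma inner_\<rho>_\<rho>: "\<rho> \<bullet> \<rho> = s\<^sup>2 / \<alpha>\<^sup>2"
  using inner_M_last[of "v (Inr 1)"] by (simp add: \<rho>_eq inner_v_v power2_eq_square)

definition P :: "real^('n::_)^('n::_)" where "P = transpose A ** A - mat (s\<^sup>2)"

lemma inner_P_raw: "(P *v y) \<bullet> y' = (A *v y) \<bullet> (A *v y') - s\<^sup>2 * (y \<bullet> y')"
proof -
  have "mat (s\<^sup>2) *v y = s\<^sup>2 *\<^sub>R y"
    by (metis mat_eq_scaleR_mat_1 scaleR_matrix_vector_assoc matrix_vector_mul_lid)
  then show ?thesis
    by (simp add: P_def matrix_vector_mult_diff_rdistrib inner_diff_left inner_Gram_matrix_mult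
        del: vector_transpose_matrix)
qed

text \<open>The terms with \<open>x\<close> in \<open>inner_A\<close> and in
  \<open>s\<^sup>2\<close> times \<open>Parseval_w\<close> cancel.\<close>

lemma inner_P: "(P *v y) \<bullet> y' = (\<Sum>i\<in>UNIV. d i * ((w i \<bullet> y) * (w i \<bullet> y')))"
  unfolding inner_P_raw inner_A Parseval_w[of y y', symmetric]
  by (simp add: d_def left_diff_distrib sum_subtractf sum_distrib_left distrib_left)

text \<open>A vector in the kernel satisfies \<open>norm (A *v y) = s * norm y\<close>, which the
  separation hypothesis permits only for \<open>y = 0\<close>.\<close>

lemma invertible_P: "invertible P"
proof -
  have "y = 0" if "P *v y = 0" for y
  proof (rule ccontr)
    assume "y \<noteq> 0"
    have "(s * norm y)\<^sup>2 < (smallest_singular_value A * norm y)\<^sup>2"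
      using sep \<sigma>_pos \<open>y \<noteq> 0\<close> by (intro power_strict_mono) auto
    also have "\<dots> \<le> (norm (A *v y))\<^sup>2"
      using smallest_singular_value_le[of A y] smallest_singular_value_nonneg[of A]
      by (intro power_mono) auto
    finally show False
      using inner_P_raw[of y y] that by (simp add: power2_norm_eq_inner power_mult_distrib)
  qed
  then have "\<exists>B. B ** P = mat 1" by (simp add: matrix_left_invertible_ker)
  then show ?thesis by (simp add: invertible_left_inverse)
qed

lemma P_x: "P *v x = transpose A *v b"
proof (rule vector_eq_rdot[THEN iffD1], rule allI)
  fix y
  show "(P *v x) \<bullet> y = (transpose A *v b) \<bullet> y"
    using inner_\<rho>_A[of y] unfolding inner_P_raw inner_transpose_matrix_vector_mult
    by (simp add: \<rho>_def inner_diff_left)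
qed

text \<open>Links the closed form in \<open>tls_map\<close> with the minimiser from
  \<open>tls_solution\<close>.\<close>

lemma tls_value: "matrix_inv P *v (transpose A *v b) = x"
  by (metis P_x matrix_inv_mult(2)[OF invertible_P] matrix_vector_mul_assoc matrix_vector_mul_lid)

section \<open>Differentiation of the closed form\<close>

definition tls_deriv :: "(real^('n::_)^'m) \<times> (real^'m) \<Rightarrow> real^('n::_)" where
  "tls_deriv h = matrix_inv P *v (transpose (fst h) *v \<rho> + transpose A *v (snd h - fst h *v x)
     + (2 * \<alpha>\<^sup>2 * (\<rho> \<bullet> (snd h - fst h *v x))) *\<^sub>R x)"

text \<open>The squared smallest singular value is differentiable by \<open>spectral_gap\<close>,
  the Gram matrix and the right-hand side by the product rule;
  \<open>has_derivative_matrix_inv_mult\<close> combines them.\<close>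

lemma tls_map_has_derivative: "(tls_map has_derivative tls_deriv) (at (A, b))"
proof -
  obtain \<gamma> where \<gamma>: "0 < \<gamma>"
    "\<And>u. s\<^sup>2 * (norm u)\<^sup>2 + \<gamma> * ((norm u)\<^sup>2 - (v (Inr 1) \<bullet> u)\<^sup>2) \<le> (norm (M *v u))\<^sup>2"
    by (rule spectral_gap) blast
  have "norm (v (Inr 1)) = 1" by (simp add: norm_eq_1 inner_v_v)
  note ssv = smallest_singular_value_sq_has_derivative[OF this \<gamma>(1) norm_M_last \<gamma>(2)]
  have s: "smallest_singular_value M = s"
    using norm_M_last ssv(1) \<sigma>_pos by (simp add: power2_eq_iff_nonneg)
  define F where "F = (\<lambda>p. snoc_col (fst p) (snd p) :: real^('n + 1)^'m)"
  have F: "(F has_derivative F) (at p)" for p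
    unfolding F_def using bounded_linear_snoc_col by (rule bounded_linear_imp_has_derivative)
  define \<delta> where "\<delta> h = snd h - fst h *v x" for h :: "(real^('n::_)^'m) \<times> (real^'m)"
  have FAb: "F (A, b) = M" by (simp add: F_def)
  have lam: "((\<lambda>p. (smallest_singular_value (F p))\<^sup>2) has_derivative
      (\<lambda>h. 2 * \<alpha>\<^sup>2 * (\<rho> \<bullet> \<delta> h))) (at (A, b))"
  proof -
    have "((\<lambda>p. (smallest_singular_value (F p))\<^sup>2) has_derivative
        (\<lambda>h. 2 * ((M *v v (Inr 1)) \<bullet> (F h *v v (Inr 1))))) (at (A, b))"
      using has_derivative_compose[OF F[of "(A, b)"] ssv(2)[folded FAb]] by (simp add: FAb)
    \<comment> \<open>Both factors carry \<open>- \<alpha>\<close>: the image of the last singular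
      vector is \<open>- \<alpha>\<close> times \<open>\<rho>\<close> under \<open>M\<close> and
      \<open>- \<alpha>\<close> times \<open>\<delta> h\<close> under \<open>F h\<close>.\<close>
    moreover have "2 * ((M *v v (Inr 1)) \<bullet> (F h *v v (Inr 1))) = 2 * \<alpha>\<^sup>2 * (\<rho> \<bullet> \<delta> h)" for h
      by (simp add: F_def v_Inr \<rho>_def \<delta>_def matrix_vector_mult_scaleR inner_simps
          power2_eq_square algebra_simps)
    ultimately show ?thesis by simp
  qed
  have fst: "(fst has_derivative fst) (at (A, b))" and snd: "(snd has_derivative snd) (at (A, b))"
    by (auto intro: bounded_linear_imp_has_derivative bounded_linear_fst bounded_linear_snd)
  note tr = bounded_linear.has_derivative[OF bounded_linear_transpose fst]
  note Gram = bounded_bilinear.FDERIV[OF bounded_bilinear_matrix_matrix_mult tr fst]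
  note rhs = bounded_bilinear.FDERIV[OF bounded_bilinear_matrix_vector_mult tr snd]
  note PP = has_derivative_diff[OF Gram has_derivative_scaleR_left[OF lam, of "mat 1"]]
  have P: "transpose (fst (A, b)) ** fst (A, b)
      - (smallest_singular_value (F (A, b)))\<^sup>2 *\<^sub>R mat 1 = P"
    by (simp add: P_def FAb s mat_eq_scaleR_mat_1[of "s\<^sup>2"])
  have map: "tls_map = (\<lambda>p. matrix_inv (transpose (fst p) ** fst p
      - (smallest_singular_value (F p))\<^sup>2 *\<^sub>R mat 1) *v (transpose (fst p) *v snd p))"
    unfolding tls_map_def F_def by (simp add: fun_eq_iff mat_eq_scaleR_mat_1[of "(_)\<^sup>2"])
  \<comment> \<open>The product-rule expression is regrouped so that \<open>b - A *v x\<close>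
    appears as \<open>\<rho>\<close>.\<close>
  have deriv: "tls_deriv = (\<lambda>h. matrix_inv P *v (transpose A *v snd h + transpose (fst h) *v b
      - (transpose A ** fst h + transpose (fst h) ** A - (2 * \<alpha>\<^sup>2 * (\<rho> \<bullet> \<delta> h)) *\<^sub>R mat 1) *v x))"
  proof
    fix h
    have "transpose (fst h) *v \<rho> + transpose A *v (snd h - fst h *v x)
        + (2 * \<alpha>\<^sup>2 * (\<rho> \<bullet> (snd h - fst h *v x))) *\<^sub>R x
      = transpose A *v snd h + transpose (fst h) *v b
      - (transpose A ** fst h + transpose (fst h) ** A - (2 * \<alpha>\<^sup>2 * (\<rho> \<bullet> \<delta> h)) *\<^sub>R mat 1) *v x"
      unfolding \<rho>_def \<delta>_def matrix_vector_mult_diff_distrib matrix_vector_mult_diff_rdistrib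
        matrix_vector_mult_add_rdistrib matrix_vector_mul_assoc[symmetric]
        scaleR_matrix_vector_assoc[symmetric] matrix_vector_mul_lid
      by simp
    then show "tls_deriv h = matrix_inv P *v (transpose A *v snd h + transpose (fst h) *v b
      - (transpose A ** fst h + transpose (fst h) ** A - (2 * \<alpha>\<^sup>2 * (\<rho> \<bullet> \<delta> h)) *\<^sub>R mat 1) *v x)"
      by (simp only: tls_deriv_def)
  qed
  show ?thesis
    using has_derivative_matrix_inv_mult[OF PP rhs, unfolded P, OF invertible_P]
    unfolding map deriv by (simp only: fst_conv snd_conv tls_value)
qed

section \<open>The adjoint of the derivative\<close>

lemma tls_cond_eq: "tls_cond A b = onorm tls_deriv"
  unfolding tls_cond_def using frechet_derivative_at[OF tls_map_has_derivative] by simp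

text \<open>The transposed Jacobian. The vector \<open>q\<close> pairs with
  \<open>snd h - fst h *v x\<close>, which accounts for both \<open>q\<close> and
  \<open>- outer q x\<close>; \<open>outer \<rho> z\<close> comes from the term
  \<open>transpose (fst h) *v \<rho>\<close>.\<close>

definition tls_adj :: "real^('n::_) \<Rightarrow> (real^('n::_)^'m) \<times> (real^'m)" where
  "tls_adj y = (let z = matrix_inv P *v y; q = A *v z + (2 * \<alpha>\<^sup>2 * (x \<bullet> z)) *\<^sub>R \<rho>
     in (outer \<rho> z - outer q x, q))"

lemma P_symmetric: "(P *v y) \<bullet> y' = y \<bullet> (P *v y')"
  unfolding inner_commute[of y] inner_P by (simp add: mult_ac)

lemma P_inv: "P *v (matrix_inv P *v y) = y"
  by (simp add: matrix_vector_mul_assoc matrix_inv_mult[OF invertible_P])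

lemma tls_adj: "tls_deriv h \<bullet> y = h \<bullet> tls_adj y"
proof -
  define z where "z = matrix_inv P *v y"
  define \<delta> where "\<delta> = snd h - fst h *v x"
  define q where "q = A *v z + (2 * \<alpha>\<^sup>2 * (x \<bullet> z)) *\<^sub>R \<rho>"
  have y: "y = P *v z" by (simp add: z_def P_inv)
  have "tls_deriv h \<bullet> y = (P *v tls_deriv h) \<bullet> z"
    unfolding y by (simp add: P_symmetric)
  also have "\<dots> = (transpose (fst h) *v \<rho> + transpose A *v \<delta> + (2 * \<alpha>\<^sup>2 * (\<rho> \<bullet> \<delta>)) *\<^sub>R x) \<bullet> z"
    by (simp only: tls_deriv_def P_inv \<delta>_def)
  also have "\<dots> = \<rho> \<bullet> (fst h *v z) + \<delta> \<bullet> q"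
    unfolding inner_add_left inner_transpose_matrix_vector_mult q_def
    by (simp add: inner_simps inner_commute)
  also have "\<dots> = fst h \<bullet> (outer \<rho> z - outer q x) + snd h \<bullet> q"
    by (simp add: inner_diff_right inner_outer_right \<delta>_def inner_diff_left inner_commute)
  also have "\<dots> = h \<bullet> tls_adj y"
    by (simp add: tls_adj_def Let_def inner_prod_def z_def q_def)
  finally show ?thesis .
qed

definition t :: "'n \<Rightarrow> real^('n::_)" where "t i = w i + \<beta> $ i *\<^sub>R x"

lemma inner_w_t: "w j \<bullet> t i = (if i = j then 1 else 0)"
  by (auto simp: t_def inner_simps inner_w_w inner_w_x)

text \<open>By duality \<open>P\<close> maps \<open>t i\<close> to \<open>d i *\<^sub>R w i\<close>;
  this trades coordinates of \<open>z\<close> for coordinates of \<open>y = P *v z\<close>.\<close>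

lemma inner_t_P: "t i \<bullet> (P *v z) = d i * (w i \<bullet> z)"
proof -
  have "(P *v t i) \<bullet> z = (\<Sum>j\<in>UNIV. if j = i then d i * (w i \<bullet> z) else 0)"
    unfolding inner_P inner_w_t by (intro sum.cong) auto
  then show ?thesis by (simp add: P_symmetric)
qed

lemma norm_tls_adj: "norm (tls_adj y) = L2_set (\<lambda>i. s_coeff \<sigma> i * (t i \<bullet> y)) UNIV / \<alpha>"
proof -
  define z where "z = matrix_inv P *v y"
  \<comment> \<open>By \<open>inner_\<rho>_A\<close> and \<open>inner_\<rho>_\<rho>\<close>,
    \<open>q\<close> is the reflection of \<open>A *v z\<close> in the hyperplane orthogonal to
    \<open>\<rho>\<close>. Hence its norm is that of \<open>A *v z\<close>, and its inner product
    with \<open>\<rho>\<close> changes sign.\<close>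
  define q where "q = A *v z + (2 * \<alpha>\<^sup>2 * (x \<bullet> z)) *\<^sub>R \<rho>"
  have \<alpha>0: "\<alpha> \<noteq> 0" using \<alpha>_pos by simp
  have \<rho>q: "\<rho> \<bullet> q = s\<^sup>2 * (x \<bullet> z)"
    using \<alpha>0 by (simp add: q_def inner_simps inner_\<rho>_A inner_\<rho>_\<rho>)
  have "q \<bullet> q = (A *v z) \<bullet> (A *v z) + 2 * (2 * \<alpha>\<^sup>2 * (x \<bullet> z)) * (\<rho> \<bullet> (A *v z))
      + (2 * \<alpha>\<^sup>2 * (x \<bullet> z))\<^sup>2 * (\<rho> \<bullet> \<rho>)"
    by (simp add: q_def inner_simps inner_commute[of "A *v z" \<rho>] power2_eq_square algebra_simps)
  also have "\<dots> = (A *v z) \<bullet> (A *v z)"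
    unfolding inner_\<rho>_A inner_\<rho>_\<rho> using \<alpha>0 by (simp add: field_simps power2_eq_square)
  finally have qq: "q \<bullet> q = (A *v z) \<bullet> (A *v z)" .
  have "tls_adj y = (outer \<rho> z - outer q x, q)"
    by (simp add: tls_adj_def Let_def z_def q_def)
  then have "(norm (tls_adj y))\<^sup>2
      = (\<rho> \<bullet> \<rho>) * (z \<bullet> z) - 2 * (\<rho> \<bullet> q) * (x \<bullet> z) + (1 + x \<bullet> x) * (q \<bullet> q)"
    by (simp add: power2_norm_eq_inner inner_simps inner_outer_outer inner_commute[of q \<rho>]
        inner_commute[of z x] algebra_simps)
  also have "\<dots> = s\<^sup>2 / \<alpha>\<^sup>2 * (z \<bullet> z) - 2 * s\<^sup>2 * (x \<bullet> z)\<^sup>2 + (A *v z) \<bullet> (A *v z) / \<alpha>\<^sup>2"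
    by (simp add: one_plus_x \<rho>q qq inner_\<rho>_\<rho> power2_eq_square)
  \<comment> \<open>The multiples of \<open>(x \<bullet> z)\<^sup>2\<close> cancel: each expansion
    contributes \<open>s\<^sup>2\<close>, against \<open>- 2 * s\<^sup>2\<close>.\<close>
  also have "\<dots> = (\<Sum>i\<in>UNIV. ((\<sigma> $ Inl i)\<^sup>2 + s\<^sup>2) * (w i \<bullet> z)\<^sup>2) / \<alpha>\<^sup>2"
    unfolding inner_A Parseval_w[of z z, symmetric]
    using \<alpha>0 by (simp add: sum.distrib sum_distrib_left field_simps power2_eq_square)
  also have "\<dots> = (\<Sum>i\<in>UNIV. (s_coeff \<sigma> i * (t i \<bullet> y))\<^sup>2) / \<alpha>\<^sup>2"
  proof -
    have "((\<sigma> $ Inl i)\<^sup>2 + s\<^sup>2) * (w i \<bullet> z)\<^sup>2 = (s_coeff \<sigma> i * (t i \<bullet> y))\<^sup>2" for i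
    proof -
      have "t i \<bullet> y = d i * (w i \<bullet> z)"
        using inner_t_P[of i z] by (simp add: z_def P_inv)
      moreover have "(s_coeff \<sigma> i * d i)\<^sup>2 = (\<sigma> $ Inl i)\<^sup>2 + s\<^sup>2"
        using d_pos[of i] by (simp add: s_coeff_def d_def)
      ultimately show ?thesis by (simp add: power_mult_distrib mult.assoc[symmetric])
    qed
    then show ?thesis by simp
  qed
  finally have "(norm (tls_adj y))\<^sup>2 = (L2_set (\<lambda>i. s_coeff \<sigma> i * (t i \<bullet> y)) UNIV / \<alpha>)\<^sup>2"
    by (simp add: L2_set_def power_divide sum_nonneg)
  then show ?thesis
    using \<alpha>_pos by (simp add: power2_eq_iff_nonneg)
qed

subsection \<open>Bounds for the condition number\<close>

abbreviation "\<kappa> \<equiv> tls_cond A b"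
abbreviation "l \<equiv> (Max UNIV :: 'n)"

lemma s_coeff_pos: "0 < s_coeff \<sigma> i"
  using d_pos[of i] \<sigma>_pos by (simp add: s_coeff_def d_def add_nonneg_pos)

text \<open>The square of the coefficient is \<open>1 / d i + 2 * s\<^sup>2 / (d i)\<^sup>2\<close>,
  decreasing in \<open>d i\<close>, and \<open>d\<close> is smallest at the last index.\<close>

lemma s_coeff_le: "s_coeff \<sigma> i \<le> s_coeff \<sigma> l"
proof -
  have "\<sigma> $ Inl l \<le> \<sigma> $ Inl i" using svd by (simp add: thin_svd_def)
  then have d: "d l \<le> d i"
    using \<sigma>_less[of l] \<sigma>_pos by (simp add: d_def power_mono)
  have sq: "(s_coeff \<sigma> j)\<^sup>2 = 1 / d j + 2 * s\<^sup>2 / (d j)\<^sup>2" for j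
  proof -
    have "(s_coeff \<sigma> j)\<^sup>2 = (d j + 2 * s\<^sup>2) / (d j)\<^sup>2"
      by (simp add: s_coeff_def d_def power_divide)
    then show ?thesis using d_pos[of j] by (simp add: add_divide_distrib power2_eq_square)
  qed
  have "1 / d i \<le> 1 / d l" using d d_pos[of l] by (simp add: frac_le)
  moreover have "2 * s\<^sup>2 / (d i)\<^sup>2 \<le> 2 * s\<^sup>2 / (d l)\<^sup>2"
    using d d_pos[of l] by (intro divide_left_mono power_mono mult_pos_pos) auto
  ultimately have "(s_coeff \<sigma> i)\<^sup>2 \<le> (s_coeff \<sigma> l)\<^sup>2" unfolding sq by linarith
  then show ?thesis using s_coeff_pos[of l] power2_le_imp_le less_imp_le by blast
qed

definition S where "S = sqrt (\<Sum>i\<in>UNIV. (\<beta> $ i)\<^sup>2 * (s_coeff \<sigma> i)\<^sup>2)"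

lemma S_eq: "S = L2_set (\<lambda>i. s_coeff \<sigma> i * \<beta> $ i) UNIV"
  by (simp add: S_def L2_set_def power_mult_distrib mult.commute)

lemma S_nonneg: "0 \<le> S"
  by (simp add: S_eq L2_set_nonneg)

lemma S_ge: "\<bar>\<beta> $ l\<bar> * s_coeff \<sigma> l \<le> S"
proof -
  have "S = L2_set (\<lambda>i. \<bar>s_coeff \<sigma> i * \<beta> $ i\<bar>) UNIV"
    by (simp add: S_eq L2_set_def)
  then have "\<bar>s_coeff \<sigma> l * \<beta> $ l\<bar> \<le> S"
    using member_le_L2_set[of UNIV l "\<lambda>i. \<bar>s_coeff \<sigma> i * \<beta> $ i\<bar>"] by simp
  then show ?thesis using s_coeff_pos[of l] by (simp add: abs_mult mult.commute)
qed

lemma sqrt_\<alpha>: "sqrt (1 - \<alpha>\<^sup>2) = \<alpha> * norm x"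
proof (rule real_sqrt_unique)
  show "(\<alpha> * norm x)\<^sup>2 = 1 - \<alpha>\<^sup>2"
    using \<alpha>_sq by (simp add: power_mult_distrib power2_norm_eq_inner algebra_simps)
qed (use \<alpha>_pos in auto)

text \<open>The \<open>w\<close> part is bounded by Bessel's inequality from
  \<open>Parseval_w\<close>, the \<open>x\<close> part by Cauchy-Schwarz. The resulting bound is at
  least as sharp as \<open>kappa_upper\<close>.\<close>

lemma kappa_le: "\<kappa> \<le> (s_coeff \<sigma> l + norm x * S) / \<alpha>"
  unfolding tls_cond_eq
proof (rule onorm_le_of_adjoint_le[OF tls_adj])
  fix y
  have "L2_set (\<lambda>i. s_coeff \<sigma> i * (t i \<bullet> y)) UNIV
      = L2_set (\<lambda>i. s_coeff \<sigma> i * (w i \<bullet> y) + (s_coeff \<sigma> i * \<beta> $ i) * (x \<bullet> y)) UNIV"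
    by (simp add: t_def inner_simps algebra_simps)
  also have "\<dots> \<le> L2_set (\<lambda>i. s_coeff \<sigma> i * (w i \<bullet> y)) UNIV
      + L2_set (\<lambda>i. (s_coeff \<sigma> i * \<beta> $ i) * (x \<bullet> y)) UNIV"
    by (rule L2_set_triangle_ineq)
  also have "L2_set (\<lambda>i. s_coeff \<sigma> i * (w i \<bullet> y)) UNIV \<le> s_coeff \<sigma> l * norm y"
  proof -
    have "L2_set (\<lambda>i. s_coeff \<sigma> i * (w i \<bullet> y)) UNIV
        \<le> sqrt (\<Sum>i\<in>UNIV. (s_coeff \<sigma> l)\<^sup>2 * (w i \<bullet> y)\<^sup>2)"
      unfolding L2_set_def power_mult_distrib using s_coeff_le s_coeff_pos
      by (intro real_sqrt_le_mono sum_mono mult_right_mono power_mono) (auto intro: less_imp_le)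
    also have "\<dots> \<le> sqrt ((s_coeff \<sigma> l)\<^sup>2 * (norm y)\<^sup>2)"
    proof -
      have "(\<Sum>i\<in>UNIV. (w i \<bullet> y)\<^sup>2) \<le> (norm y)\<^sup>2"
        using Parseval_w[of y y] unfolding power2_norm_eq_inner
        by (smt (verit) power2_eq_square sum.cong zero_le_power2 zero_le_mult_iff)
      then show ?thesis
        by (simp add: sum_distrib_left[symmetric] mult_left_mono)
    qed
    also have "\<dots> = s_coeff \<sigma> l * norm y"
      using s_coeff_pos[of l] by (simp add: real_sqrt_mult)
    finally show ?thesis .
  qed
  also have "L2_set (\<lambda>i. (s_coeff \<sigma> i * \<beta> $ i) * (x \<bullet> y)) UNIV \<le> norm x * S * norm y"
  proof -
    have "L2_set (\<lambda>i. (s_coeff \<sigma> i * \<beta> $ i) * (x \<bullet> y)) UNIV = S * \<bar>x \<bullet> y\<bar>"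
      by (simp add: S_eq L2_set_def power_mult_distrib real_sqrt_mult flip: sum_distrib_right)
    also have "\<dots> \<le> S * (norm x * norm y)"
      by (intro mult_left_mono Cauchy_Schwarz_ineq2 S_nonneg)
    finally show ?thesis by (simp add: mult_ac)
  qed
  finally have "norm (tls_adj y) \<le> (s_coeff \<sigma> l * norm y + norm x * S * norm y) / \<alpha>"
    using \<alpha>_pos by (simp add: norm_tls_adj divide_right_mono)
  then show "norm (tls_adj y) \<le> (s_coeff \<sigma> l + norm x * S) / \<alpha> * norm y"
    by (simp add: distrib_right)
next
  show "0 \<le> (s_coeff \<sigma> l + norm x * S) / \<alpha>"
    using s_coeff_pos[of l] S_nonneg \<alpha>_pos by (simp add: less_imp_le)
qed

lemma norm_tls_adj_le: "L2_set (\<lambda>i. s_coeff \<sigma> i * (t i \<bullet> y)) UNIV / \<alpha> \<le> \<kappa> * norm y"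
  using norm_adjoint_le_onorm[OF has_derivative_bounded_linear[OF tls_map_has_derivative] tls_adj]
  by (simp add: norm_tls_adj tls_cond_eq)

text \<open>The test vector \<open>x\<close> satisfies
  \<open>t i \<bullet> x = \<beta> $ i / \<alpha>\<^sup>2\<close>, which reproduces the sum in
  \<open>S\<close>.\<close>

lemma kappa_ge_S:
  assumes "x \<noteq> 0"
  shows "S / (\<alpha> ^ 3 * norm x) \<le> \<kappa>"
proof -
  have "t i \<bullet> x = \<beta> $ i * (1 + x \<bullet> x)" for i
    by (simp add: t_def inner_simps inner_w_x algebra_simps)
  then have "t i \<bullet> x = \<beta> $ i / \<alpha>\<^sup>2" for i
    by (simp add: one_plus_x)
  then have "L2_set (\<lambda>i. s_coeff \<sigma> i * (t i \<bullet> x)) UNIV = S / \<alpha>\<^sup>2"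
    using L2_set_right_distrib[of "1 / \<alpha>\<^sup>2" "\<lambda>i. s_coeff \<sigma> i * \<beta> $ i" UNIV]
    by (simp add: S_eq)
  then have "S / \<alpha>\<^sup>2 / \<alpha> \<le> \<kappa> * norm x" using norm_tls_adj_le[of x] by simp
  then show ?thesis
    using \<alpha>_pos assms by (simp add: field_simps power2_eq_square power3_eq_cube)
qed

text \<open>With test vector \<open>t l\<close> the summand at index \<open>l\<close> alone
  suffices, because \<open>norm (t l)\<close> is at least 1.\<close>

lemma kappa_ge_s: "s_coeff \<sigma> l / \<alpha> \<le> \<kappa>"
proof -
  have "t l \<bullet> t l = w l \<bullet> t l + \<beta> $ l * (t l \<bullet> x)"
    by (simp add: t_def inner_simps inner_commute distrib_left)
  also have "t l \<bullet> x = \<beta> $ l + \<beta> $ l * (x \<bullet> x)"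
    by (simp add: t_def inner_simps inner_w_x)
  finally have "t l \<bullet> t l = 1 + (\<beta> $ l)\<^sup>2 * (1 + x \<bullet> x)"
    by (simp add: inner_w_t power2_eq_square algebra_simps)
  then have "1 \<le> (norm (t l))\<^sup>2" by (simp add: power2_norm_eq_inner)
  then have t1: "1 \<le> norm (t l)" by (simp add: power2_nonneg_ge_1_iff)
  have "s_coeff \<sigma> l * (norm (t l))\<^sup>2 / \<alpha> \<le> L2_set (\<lambda>i. s_coeff \<sigma> i * (t i \<bullet> t l)) UNIV / \<alpha>"
    using member_le_L2_set[of UNIV l "\<lambda>i. \<bar>s_coeff \<sigma> i * (t i \<bullet> t l)\<bar>"] s_coeff_pos[of l] \<alpha>_pos
    by (intro divide_right_mono) (simp_all add: L2_set_def power2_norm_eq_inner)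
  also have "\<dots> \<le> \<kappa> * norm (t l)" by (rule norm_tls_adj_le)
  finally have "s_coeff \<sigma> l / \<alpha> * norm (t l) \<le> \<kappa>"
    using mult_right_le_imp_le[of "s_coeff \<sigma> l / \<alpha> * norm (t l)" "norm (t l)" \<kappa>] t1
    by (cases "t l = 0") (simp_all add: power2_eq_square mult.assoc)
  moreover have "s_coeff \<sigma> l / \<alpha> * 1 \<le> s_coeff \<sigma> l / \<alpha> * norm (t l)"
    using t1 s_coeff_pos[of l] \<alpha>_pos by (intro mult_left_mono) auto
  ultimately show ?thesis by simp
qed

end

text \<open>Controls the factor of the second term of \<open>kappa_lower\<close>, with
  \<open>r = sqrt (1 - \<alpha>\<^sup>2)\<close> and \<open>g\<close> the last entry of
  \<open>\<beta>\<close>.\<close>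

lemma sqrt_ratio_bounds:
  fixes r g :: real
  assumes "0 < r" "g\<^sup>2 \<le> r\<^sup>2"
  shows "sqrt (r\<^sup>2 - g\<^sup>2) / r \<le> 1" "1 - \<bar>g\<bar> / r \<le> sqrt (r\<^sup>2 - g\<^sup>2) / r"
proof -
  have "sqrt (r\<^sup>2 - g\<^sup>2) \<le> sqrt (r\<^sup>2)" by (intro real_sqrt_le_mono) simp
  then show "sqrt (r\<^sup>2 - g\<^sup>2) / r \<le> 1" using assms by simp
  have g: "\<bar>g\<bar> \<le> r" using assms by (simp add: abs_le_square_iff[symmetric])
  have "0 \<le> 2 * \<bar>g\<bar> * (r - \<bar>g\<bar>)" using g by simp
  then have "(r - \<bar>g\<bar>)\<^sup>2 \<le> r\<^sup>2 - g\<^sup>2"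
    by (simp add: power2_eq_square algebra_simps abs_mult_self_eq)
  then have "r - \<bar>g\<bar> \<le> sqrt (r\<^sup>2 - g\<^sup>2)" by (rule real_le_rsqrt)
  then have "(r - \<bar>g\<bar>) / r \<le> sqrt (r\<^sup>2 - g\<^sup>2) / r" using assms by (intro divide_right_mono) auto
  then show "1 - \<bar>g\<bar> / r \<le> sqrt (r\<^sup>2 - g\<^sup>2) / r" using assms by (simp add: diff_divide_distrib)
qed

theorem theorem7:
  fixes A :: "real^('n::{finite,linorder})^'m" and b :: "real^'m" 
    and x \<beta> :: "real^('n::{finite,linorder})"
    and U :: "real^('n + 1)^'m" and \<sigma> :: "real^('n + 1)" and V :: "real^('n + 1)^('n + 1)"
    and \<alpha> :: real
  assumes "CARD('n) < CARD('m)"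
    and "thin_svd (snoc_col A b) U \<sigma> V"
    and "0 < \<sigma> $ Inr 1"
    and "\<sigma> $ Inr 1 < smallest_singular_value A"
    and "tls_solution A b x"
    and "x \<noteq> 0"
    and "\<alpha> = 1 / sqrt (1 + (norm x)\<^sup>2)"
    and "row (Inr 1) V = snoc_vec \<beta> (- \<alpha>)"
  shows "tls_map differentiable (at (A, b)) \<and>
    kappa_lower \<alpha> \<beta> \<sigma> \<le> tls_cond A b \<and> tls_cond A b \<le> kappa_upper \<alpha> \<beta> \<sigma> \<and>
    (\<alpha> \<le> 1 / 2 \<longrightarrow>
      kappa_lower \<alpha> \<beta> \<sigma> < kappa_upper \<alpha> \<beta> \<sigma> \<and>
      kappa_upper \<alpha> \<beta> \<sigma> < 4 * kappa_lower \<alpha> \<beta> \<sigma>)"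
proof -
  interpret tls_svd A b x \<beta> U \<sigma> V \<alpha>
    by unfold_locales (fact assms)+
  \<comment> \<open>In these terms \<open>kappa_lower\<close> is the average of \<open>a\<close> and
    \<open>q * c\<close>, and \<open>kappa_upper\<close> is \<open>a + c\<close>.\<close>
  define r where "r = \<alpha> * norm x"
  define a where "a = S / (\<alpha>\<^sup>2 * r)"
  define c where "c = s_coeff \<sigma> l / \<alpha>"
  define q where "q = sqrt (r\<^sup>2 - (\<beta> $ l)\<^sup>2) / r"
  have r: "0 < r" using \<alpha>_pos assms by (simp add: r_def)
  have r2: "r\<^sup>2 = 1 - \<alpha>\<^sup>2"
    using \<alpha>_sq by (simp add: r_def power_mult_distrib power2_norm_eq_inner algebra_simps)
  have c: "0 < c" using s_coeff_pos \<alpha>_pos by (simp add: c_def)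
  have a: "0 \<le> a" using S_nonneg r by (simp add: a_def)
  have "(\<beta> $ l)\<^sup>2 \<le> r\<^sup>2"
    unfolding r2 sum_\<beta>[symmetric] by (intro member_le_sum) auto
  then have q: "q \<le> 1" "1 - \<bar>\<beta> $ l\<bar> / r \<le> q"
    using sqrt_ratio_bounds[OF r] by (auto simp: q_def)
  have lower: "kappa_lower \<alpha> \<beta> \<sigma> = 1 / 2 * (a + q * c)"
    unfolding kappa_lower_def S_def[symmetric] sqrt_\<alpha> r_def[symmetric]
    unfolding r2[symmetric] a_def q_def c_def
    by simp
  have upper: "kappa_upper \<alpha> \<beta> \<sigma> = a + c"
    unfolding kappa_upper_def S_def[symmetric] sqrt_\<alpha> r_def[symmetric] a_def c_def
    by simp
  have "a \<le> \<kappa>"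
    using kappa_ge_S assms by (simp add: a_def r_def power2_eq_square power3_eq_cube mult_ac)
  moreover have "q * c \<le> \<kappa>"
    using mult_right_mono[OF q(1), of c] c kappa_ge_s by (simp add: c_def)
  ultimately have "kappa_lower \<alpha> \<beta> \<sigma> \<le> \<kappa>" by (simp add: lower)
  moreover have "\<kappa> \<le> kappa_upper \<alpha> \<beta> \<sigma>"
  proof -
    have "norm x / \<alpha> = r / \<alpha>\<^sup>2"
      using \<alpha>_pos by (simp add: r_def power2_eq_square)
    \<comment> \<open>Only \<open>r \<le> 1\<close> is lost in passing from \<open>kappa_le\<close>
      to \<open>kappa_upper\<close>.\<close>
    also have "\<dots> \<le> 1 / (\<alpha>\<^sup>2 * r)"
    proof -
      have "r * r \<le> 1" using r2 by (simp add: power2_eq_square[symmetric])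
      then have "r \<le> 1 / r" using r by (simp add: field_simps)
      then have "r / \<alpha>\<^sup>2 \<le> 1 / r / \<alpha>\<^sup>2" by (intro divide_right_mono) auto
      then show ?thesis by (simp add: mult.commute)
    qed
    finally have "S * (norm x / \<alpha>) \<le> S * (1 / (\<alpha>\<^sup>2 * r))"
      by (intro mult_left_mono S_nonneg)
    then show ?thesis
      using kappa_le by (simp add: upper a_def c_def add_divide_distrib mult.commute)
  qed
  moreover have "kappa_lower \<alpha> \<beta> \<sigma> < kappa_upper \<alpha> \<beta> \<sigma>"
  proof -
    have "q * c \<le> 1 * c" using q(1) c by (intro mult_right_mono) auto
    moreover have "1 / 2 * (a + e) < a + c" if "e \<le> 1 * c" for e
      using that a c by simp
    ultimately show ?thesis unfolding lower upper by blast
  qed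
  moreover have "kappa_upper \<alpha> \<beta> \<sigma> < 4 * kappa_lower \<alpha> \<beta> \<sigma>" if "\<alpha> \<le> 1 / 2"
  proof -
    \<comment> \<open>Here \<open>\<alpha> \<le> 1 / 2\<close> enters as
      \<open>2 \<le> 1 / \<alpha>\<close>. The aim is \<open>2 * c \<le> a + 2 * q * c\<close>,
      whence \<open>4 * kappa_lower\<close> is at least \<open>a + 2 * c\<close>.\<close>
    have "2 * \<bar>\<beta> $ l\<bar> / r * c \<le> 1 / \<alpha> * \<bar>\<beta> $ l\<bar> / r * c"
      using that \<alpha>_pos r c by (intro mult_right_mono divide_right_mono) (auto simp: field_simps)
    also have "\<dots> = \<bar>\<beta> $ l\<bar> * s_coeff \<sigma> l / (\<alpha>\<^sup>2 * r)"
      by (simp add: c_def power2_eq_square)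
    also have "\<dots> \<le> a"
      unfolding a_def using S_ge r by (intro divide_right_mono) auto
    finally have "2 * (\<bar>\<beta> $ l\<bar> / r * c) \<le> a" by simp
    moreover have "(1 - \<bar>\<beta> $ l\<bar> / r) * c \<le> q * c"
      using q(2) c by (intro mult_right_mono) auto
    ultimately show ?thesis
      unfolding lower upper using c by (simp add: left_diff_distrib)
  qed
  ultimately show ?thesis
    using tls_map_has_derivative by (auto simp: differentiable_def)
qed

end
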